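(* For every fixed real $s>1$, we have $\lim_{r\to\infty}\zeta_r(s)=0$.
   Context: For an integer $r\geq 1$ and real $s>1$, $\zeta_r(s)=\sum_{1\leq m_1<m_2<\cdots<m_r}(m_1m_2\cdots m_r)^{-s}$ (the Euler–Zagier $r$-fold zeta-function with all arguments equal to $s$). *)

theory Defs
  imports "HOL-Analysis.Analysis"
begin

text \<open>The index tuples \<open>1 \<le> m\<^sub>1 < \<dots> < m\<^sub>r\<close> are lists of length \<open>r\<close>.\<close>

definition increasing_tuples :: "nat \<Rightarrow> nat list set" where
  "increasing_tuples r =
     {ms. length ms = r \<and> sorted_wrt (<) ms \<and> (\<forall>m\<in>set ms. 1 \<le> m)}"

text \<open>
  The sum is an unordered sum; all terms are positive, so the order of summation is
  immaterial. As \<open>infsum\<close> is \<open>0\<close> by convention on non-summable families,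
  \<open>summable_euler_zagier_zeta\<close> below records that the series converges for \<open>s > 1\<close>.
  The paper only uses \<open>r \<ge> 1\<close>; for \<open>r = 0\<close> the value is that of the empty tuple, \<open>1\<close>.
\<close>

definition euler_zagier_zeta :: "nat \<Rightarrow> real \<Rightarrow> real" where
  "euler_zagier_zeta r s =
     (\<Sum>\<^sub>\<infinity>ms\<in>increasing_tuples r. real (prod_list ms) powr (- s))"

lemma sum_lists_prod_list:
  fixes f :: "'a \<Rightarrow> real"
  assumes "finite A"
  shows "(\<Sum>ms | set ms \<subseteq> A \<and> length ms = r. prod_list (map f ms)) = (sum f A) ^ r"
proof (induction r)
  case 0
  have "{ms. set ms \<subseteq> A \<and> length ms = 0} = {[]}" by auto
  then show ?case by simp
next
  case (Suc r)
  let ?L = "{ms. set ms \<subseteq> A \<and> length ms = r}"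
  have eq: "{ms. set ms \<subseteq> A \<and> length ms = Suc r} = (\<lambda>(x, ms). x # ms) ` (A \<times> ?L)"
    by (auto simp: length_Suc_conv image_iff)
  have inj: "inj_on (\<lambda>(x, ms). x # ms) (A \<times> ?L)"
    by (auto simp: inj_on_def)
  have "(\<Sum>ms | set ms \<subseteq> A \<and> length ms = Suc r. prod_list (map f ms))
      = (\<Sum>(x, ms)\<in>A \<times> ?L. f x * prod_list (map f ms))"
    unfolding eq by (subst sum.reindex[OF inj]) (simp add: case_prod_unfold)
  also have "\<dots> = sum f A * (\<Sum>ms\<in>?L. prod_list (map f ms))"
    by (simp add: sum_product sum.cartesian_product)
  finally show ?case using Suc.IH by simp
qed

lemma powr_prod_list:
  "real (prod_list ms) powr a = prod_list (map (\<lambda>m. real m powr a) ms)"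
  by (induction ms) (auto simp: powr_mult)

lemma summable_euler_zagier_zeta:
  assumes "s > 1"
  shows "(\<lambda>ms. real (prod_list ms) powr (- s)) summable_on increasing_tuples r"
proof (rule nonneg_bdd_above_summable_on)
  let ?f = "\<lambda>m. real m powr (- s)"
  have smm: "summable ?f"
    using assms by (simp add: summable_real_powr_iff)
  have bound: "(\<Sum>ms\<in>F. real (prod_list ms) powr (- s)) \<le> (suminf ?f) ^ r"
    if F: "F \<subseteq> increasing_tuples r" "finite F" for F
  proof -
    define A where "A = (\<Union>ms\<in>F. set ms)"
    have fin: "finite A" using F by (auto simp: A_def)
    have sub: "F \<subseteq> {ms. set ms \<subseteq> A \<and> length ms = r}"
      using F by (auto simp: A_def increasing_tuples_def)
    have "(\<Sum>ms\<in>F. real (prod_list ms) powr (- s))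
        \<le> (\<Sum>ms | set ms \<subseteq> A \<and> length ms = r. real (prod_list ms) powr (- s))"
      by (rule sum_mono2[OF finite_lists_length_eq[OF fin] sub]) simp
    also have "\<dots> = (sum ?f A) ^ r"
      unfolding powr_prod_list by (rule sum_lists_prod_list[OF fin])
    also have "\<dots> \<le> (suminf ?f) ^ r"
      by (intro power_mono sum_le_suminf smm fin sum_nonneg) auto
    finally show ?thesis .
  qed
  then show "bdd_above (sum (\<lambda>ms. real (prod_list ms) powr (- s)) `
      {F. F \<subseteq> increasing_tuples r \<and> finite F})"
    by (intro bdd_aboveI[of _ "(suminf ?f) ^ r"]) auto
qed simp

end

(*
  The sum of zeta_r(s) over all r is the expansion of the Euler-type product of 1 + m^(-s) over
  m >= 1. Its partial products are at most exp(zeta(s)) since 1 + x <= exp x, so the series over r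
  converges and its terms tend to 0.
*)
theory Submission
  imports Defs
begin

text \<open>A strictly sorted list is determined by its set, so the left side is a sum of
  \<open>prod f B\<close> over distinct finite sets \<open>B\<close>. Adding the missing subsets of
  the union only adds nonnegative terms and completes the expansion of a product of factors
  \<open>f m + 1\<close>.\<close>

lemma sum_strict_sorted_prod_list_le_exp:
  fixes f :: "'a::linorder \<Rightarrow> real"
  assumes "finite F" and sorted: "\<And>ms. ms \<in> F \<Longrightarrow> sorted_wrt (<) ms"
    and nonneg: "\<And>m. 0 \<le> f m"
  shows "(\<Sum>ms\<in>F. prod_list (map f ms)) \<le> exp (sum f (\<Union>ms\<in>F. set ms))"
proof -
  define A where "A = (\<Union>ms\<in>F. set ms)"
  have fin: "finite A"
    using assms(1) by (simp add: A_def)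
  have inj: "inj_on set F"
    using sorted by (auto intro!: inj_onI strict_sorted_equal)
  have "(\<Sum>ms\<in>F. prod_list (map f ms)) = (\<Sum>ms\<in>F. prod f (set ms))"
    using sorted by (intro sum.cong refl)
      (simp add: prod.distinct_set_conv_list strict_sorted_iff)
  also have "\<dots> = (\<Sum>B\<in>set ` F. prod f B)"
    by (simp add: sum.reindex[OF inj])
  also have "\<dots> \<le> (\<Sum>B\<in>Pow A. prod f B)"
    by (intro sum_mono2) (use fin in \<open>auto simp: A_def intro: prod_nonneg nonneg\<close>)
  also have "\<dots> = (\<Prod>m\<in>A. f m + 1)"
    using prod_add[OF fin, of f "\<lambda>_. 1"] by simp
  also have "\<dots> \<le> (\<Prod>m\<in>A. exp (f m))"
    by (intro prod_mono) (use nonneg in \<open>auto simp: add.commute add_nonneg_nonneg\<close>)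
  also have "\<dots> = exp (sum f A)"
    by (simp add: exp_sum fin)
  finally show ?thesis
    by (simp add: A_def)
qed

text \<open>Treating all lengths at once makes the bound on finite partial sums independent of
  \<open>r\<close>; a bound for each \<open>r\<close> separately would not force decay.\<close>

lemma summable_on_Sigma_increasing_tuples:
  assumes "s > 1"
  shows "(\<lambda>(r, ms). real (prod_list ms) powr (- s)) summable_on (SIGMA r:UNIV. increasing_tuples r)"
proof (rule nonneg_bdd_above_summable_on)
  \<comment> \<open>Since \<open>0 powr (- s) = 0\<close>, the index 0 contributes nothing and
    \<open>suminf ?f\<close> is zeta(s).\<close>
  let ?f = "\<lambda>m. real m powr (- s)"
  have smm: "summable ?f"
    using assms by (simp add: summable_real_powr_iff)
  have "(\<Sum>(r, ms)\<in>F. real (prod_list ms) powr (- s)) \<le> exp (suminf ?f)"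
    if F: "F \<subseteq> (SIGMA r:UNIV. increasing_tuples r)" "finite F" for F
  proof -
    have inj: "inj_on snd F"
      proof (rule inj_onI)
      fix x y assume "x \<in> F" "y \<in> F" "snd x = snd y"
      moreover have "fst z = length (snd z)" if "z \<in> F" for z
        using F(1) that by (auto simp: increasing_tuples_def)
      ultimately show "x = y"
        by (simp add: prod_eq_iff)
    qed
    have "(\<Sum>(r, ms)\<in>F. real (prod_list ms) powr (- s))
        = (\<Sum>ms\<in>snd ` F. prod_list (map ?f ms))"
      by (simp add: sum.reindex[OF inj] case_prod_unfold powr_prod_list)
    also have "\<dots> \<le> exp (sum ?f (\<Union>ms\<in>snd ` F. set ms))"
      using F by (intro sum_strict_sorted_prod_list_le_exp) (auto simp: increasing_tuples_def)
    also have "\<dots> \<le> exp (suminf ?f)"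
      using F(2) by (subst exp_le_cancel_iff, intro sum_le_suminf smm) auto
    finally show ?thesis .
  qed
  then show "bdd_above (sum (\<lambda>(r, ms). real (prod_list ms) powr (- s)) `
      {F. F \<subseteq> (SIGMA r:UNIV. increasing_tuples r) \<and> finite F})"
    by (intro bdd_aboveI[of _ "exp (suminf ?f)"]) auto
qed auto

theorem theorem6:
  fixes s :: real
  assumes "s > 1"
  shows "(\<lambda>r. euler_zagier_zeta r s) \<longlonglongrightarrow> 0"
proof -
  \<comment> \<open>Summing the joint family first over the tuples of each fixed length leaves a
    summable family in \<open>r\<close>.\<close>
  have "(\<lambda>r. euler_zagier_zeta r s) summable_on UNIV"
    using summable_on_Sigma_banach[OF summable_on_Sigma_increasing_tuples[OF assms]]
    by (simp add: euler_zagier_zeta_def)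
  then show ?thesis
    by (intro summable_LIMSEQ_zero summable_on_imp_summable)
qed

end
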